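(* Let $a,b,c,d\in\mathbb{Z}$ be integers such that $a\equiv 0$, $b\equiv 2$, $c\equiv 1$, $d\equiv 4\pmod 8$. Then the skew pentagram map $T_{a,b,c,d}:(\mathbb{P}^2_{\mathbb{C}})^{\mathbb{Z}}\dashrightarrow(\mathbb{P}^2_{\mathbb{C}})^{\mathbb{Z}}$ satisfies $\lambda_1(T_{a,b,c,d})=4$.
   Context: Work over $\mathbb{C}$; $\operatorname{Ind}$ denotes the indeterminacy locus of a rational map. A local rule on $(\mathbb{P}^N)^{\mathbb{Z}}$ is a finite nonempty set $S\subset\mathbb{Z}$ (a neighborhood) with a rational map $\varphi:(\mathbb{P}^N)^S\dashrightarrow\mathbb{P}^N$. The associated lattice map is the partially defined map $T_\varphi:(\mathbb{P}^N)^{\mathbb{Z}}\dashrightarrow(\mathbb{P}^N)^{\mathbb{Z}}$, $(v_i)_{i}\mapsto(\varphi(v_{i+s}:s\in S))_{i}$. For finite nonempty $A\subset\mathbb{Z}$, the regional map $\varphi_A:(\mathbb{P}^N)^{A+S}\dashrightarrow(\mathbb{P}^N)^A$ is $v\mapsto(\varphi(v_{i+s}:s\in S))_{i\in A}$, where $A+S$ is the Minkowski sum. If $T,T'$ have local rules $(S,\varphi),(S',\varphi')$ and the image of $\varphi_{S'}$ is not contained in $\operatorname{Ind}\varphi'$, then $T'$ and $T$ are composable and $T'\circ T$ is the lattice map with local rule $\varphi'\circ\varphi_{S'}$ on $S+S'$. Iterates are $T^0=\mathrm{Id}$, $T^m=T\circ T^{m-1}$; $T$ is iterable if all iterates exist.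 The degree $\deg T$ of a lattice map is the total degree of the multihomogeneous polynomials giving a local rule $\varphi$ of $T$ when written without common factors. The dynamical degree of an iterable lattice map is $\lambda_1(T)=\lim_{m\to\infty}(\deg T^m)^{1/m}$ (the limit exists). For distinct $a,b,c,d\in\mathbb{Z}$, the skew pentagram map $T_{a,b,c,d}$ is the lattice map on $(\mathbb{P}^2)^{\mathbb{Z}}$ with $S=\{a,b,c,d\}$ sending $(v_i)$ to $(v_i')$ with $v_i'=\overline{v_{i+a}v_{i+b}}\cap\overline{v_{i+c}v_{i+d}}$, where $\overline{pq}$ is the line through distinct points $p,q$. It is iterable. *)

theory Defs
  imports
    "HOL-Analysis.Finite_Cartesian_Product"
    "HOL-Library.Poly_Mapping"
    "HOL-Library.Numeral_Type"
    "HOL-Library.FuncSet"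
    "HOL-Number_Theory.Cong"
begin

section \<open>Complex projective space\<close>

text \<open>
  \<open>'n pspace\<close> is \<open>P\<^sup>N\<close> over the complex numbers with \<open>N + 1 = CARD('n)\<close>: nonzero vectors up to
  nonzero scalars. The relation is partial because the zero vector is not in its domain; the
  value of \<open>abs_pspace\<close> at zero is meaningless and is never used below.
\<close>

definition proportional :: "complex ^ 'n \<Rightarrow> complex ^ 'n \<Rightarrow> bool" where
  "proportional x y \<longleftrightarrow> x \<noteq> 0 \<and> y \<noteq> 0 \<and> (\<exists>c. c \<noteq> 0 \<and> y = c *s x)"

quotient_type 'n pspace = "complex ^ 'n" / partial: proportional
proof (rule part_equivpI)
  show "\<exists>x :: complex ^ 'n. proportional x x"
    by (rule exI[of _ "1"]) (auto simp: proportional_def intro: exI[of _ 1])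
  show "symp (proportional :: complex ^ 'n \<Rightarrow> _)"
  proof (rule sympI)
    fix x y :: "complex ^ 'n"
    assume "proportional x y"
    then obtain c where c: "x \<noteq> 0" "y \<noteq> 0" "c \<noteq> 0" "y = c *s x"
      by (auto simp: proportional_def)
    have "x = inverse c *s y"
      using c by (simp add: vec_eq_iff)
    then show "proportional y x"
      using c unfolding proportional_def by (metis inverse_nonzero_iff_nonzero)
  qed
  show "transp (proportional :: complex ^ 'n \<Rightarrow> _)"
  proof (rule transpI)
    fix x y z :: "complex ^ 'n"
    assume "proportional x y" "proportional y z"
    then obtain c d where "x \<noteq> 0" "z \<noteq> 0" "c \<noteq> 0" "d \<noteq> 0" "y = c *s x" "z = d *s y"
      by (auto simp: proportional_def)
    then show "proportional x z"
      unfolding proportional_def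
      by (intro conjI exI[of _ "d * c"]) (simp_all add: vec_eq_iff mult.assoc)
  qed
qed

type_synonym 'n config = "int \<Rightarrow> 'n pspace"

definition proj_line :: "'n::finite pspace \<Rightarrow> 'n pspace \<Rightarrow> 'n pspace set" where
  "proj_line p q = {r. \<exists>\<alpha> \<beta>. rep_pspace r = \<alpha> *s rep_pspace p + \<beta> *s rep_pspace q}"


section \<open>Polynomials in the homogeneous coordinates of a configuration\<close>

text \<open>
  As in \<^theory>\<open>HOL-Library.Poly_Mapping\<close>, the inner mapping is a monomial with its exponents.
  The variable \<open>(s, j)\<close> is the \<open>j\<close>-th homogeneous coordinate of the point at position \<open>s\<close>.
\<close>

type_synonym 'n cpoly = "((int \<times> 'n) \<Rightarrow>\<^sub>0 nat) \<Rightarrow>\<^sub>0 complex"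

definition Var :: "int \<times> 'n \<Rightarrow> 'n cpoly" where
  "Var x = Poly_Mapping.single (Poly_Mapping.single x 1) 1"

definition Const :: "complex \<Rightarrow> 'n cpoly" where
  "Const c = Poly_Mapping.single 0 c"

text \<open>
  The homomorphism given by \<open>\<iota>\<close> on coefficients and \<open>f\<close> on variables. It is used with \<open>\<iota> = id\<close>
  for evaluation and with \<open>\<iota> = Const\<close> for substitution of polynomials.
\<close>

definition poly_hom ::
    "(complex \<Rightarrow> 'r::comm_semiring_1) \<Rightarrow> (int \<times> 'n \<Rightarrow> 'r) \<Rightarrow> 'n cpoly \<Rightarrow> 'r" where
  "poly_hom \<iota> f p =
     (\<Sum>m\<in>Poly_Mapping.keys p. \<iota> (Poly_Mapping.lookup p m) *
        (\<Prod>x\<in>Poly_Mapping.keys m. f x ^ Poly_Mapping.lookup m x))"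

definition shift_poly :: "int \<Rightarrow> 'n cpoly \<Rightarrow> 'n cpoly" where
  "shift_poly k = poly_hom Const (\<lambda>(s, j). Var (s + k, j))"

definition multihomogeneous :: "(int \<Rightarrow> nat) \<Rightarrow> 'n::finite cpoly \<Rightarrow> bool" where
  "multihomogeneous \<delta> p \<longleftrightarrow>
     (\<forall>m\<in>Poly_Mapping.keys p. \<forall>s. (\<Sum>j\<in>UNIV. Poly_Mapping.lookup m (s, j)) = \<delta> s)"

definition no_common_factor :: "('n \<Rightarrow> 'n cpoly) \<Rightarrow> bool" where
  "no_common_factor F \<longleftrightarrow> (\<forall>H. (\<forall>j. H dvd F j) \<longrightarrow> H dvd 1)"

definition cancel_common :: "('n \<Rightarrow> 'n cpoly) \<Rightarrow> ('n \<Rightarrow> 'n cpoly)" where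
  "cancel_common F = (SOME G. (\<exists>H. \<forall>j. F j = H * G j) \<and> no_common_factor G)"


section \<open>Local rules\<close>

text \<open>
  A local rule is a pair \<open>(S, F)\<close>. The rational map \<open>\<phi>\<close> from \<open>(P\<^sup>N)\<^sup>S\<close> to \<open>P\<^sup>N\<close> is given by its
  tuple \<open>F\<close> of multihomogeneous polynomials without common factor, which is unique up to a
  nonzero constant. Hence \<open>Ind \<phi>\<close> is the common zero set of \<open>F\<close>. A point of \<open>(P\<^sup>N)\<^sup>S\<close> is given by
  any \<open>v :: 'n config\<close>, of which only the values on \<open>S\<close> matter. Multihomogeneity makes \<open>Ind\<close>
  and \<open>rat_apply\<close> independent of the representatives picked by \<open>rep_pspace\<close>.
\<close>

type_synonym 'n rule = "int set \<times> ('n \<Rightarrow> 'n cpoly)"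

definition local_rule :: "'n::finite rule \<Rightarrow> bool" where
  "local_rule R \<longleftrightarrow> (case R of (S, F) \<Rightarrow>
     finite S \<and> S \<noteq> {} \<and>
     (\<exists>\<delta>. (\<forall>s. s \<notin> S \<longrightarrow> \<delta> s = 0) \<and> (\<forall>j. multihomogeneous \<delta> (F j))) \<and>
     (\<exists>j. F j \<noteq> 0) \<and> no_common_factor F)"

definition eval_at :: "'n::finite config \<Rightarrow> 'n cpoly \<Rightarrow> complex" where
  "eval_at v = poly_hom id (\<lambda>(s, j). rep_pspace (v s) $ j)"

definition Ind :: "('n::finite \<Rightarrow> 'n cpoly) \<Rightarrow> 'n config set" where
  "Ind F = {v. \<forall>j. eval_at v (F j) = 0}"

definition rat_apply :: "('n::finite \<Rightarrow> 'n cpoly) \<Rightarrow> 'n config \<Rightarrow> 'n pspace" where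
  "rat_apply F v = abs_pspace (\<chi> j. eval_at v (F j))"

definition shift :: "int \<Rightarrow> 'n::finite config \<Rightarrow> 'n config" where
  "shift i v = (\<lambda>s. v (i + s))"

definition lattice_map :: "'n::finite rule \<Rightarrow> ('n config \<rightharpoonup> 'n config)" where
  "lattice_map R v =
     (if \<forall>i. shift i v \<notin> Ind (snd R) then Some (\<lambda>i. rat_apply (snd R) (shift i v)) else None)"

definition regional_dom :: "int set \<Rightarrow> 'n::finite rule \<Rightarrow> 'n config set" where
  "regional_dom A R = {v. \<forall>i\<in>A. shift i v \<notin> Ind (snd R)}"

definition regional :: "int set \<Rightarrow> 'n::finite rule \<Rightarrow> 'n config \<Rightarrow> 'n config" where
  "regional A R v = (\<lambda>i\<in>A. rat_apply (snd R) (shift i v))"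

text \<open>
  In both definitions below, the lattice map of the first rule is applied after that of the second.
\<close>

definition composable :: "'n::finite rule \<Rightarrow> 'n rule \<Rightarrow> bool" where
  "composable R' R \<longleftrightarrow> \<not> regional (fst R') R ` regional_dom (fst R') R \<subseteq> Ind (snd R')"

definition compose_rule :: "'n::finite rule \<Rightarrow> 'n rule \<Rightarrow> 'n rule" where
  "compose_rule R' R =
     ({s + s' | s s'. s \<in> fst R \<and> s' \<in> fst R'},
      cancel_common (\<lambda>j. poly_hom Const (\<lambda>(s', l). shift_poly s' (snd R l)) (snd R' j)))"

text \<open>
  For \<open>N \<ge> 1\<close> the coordinates of a point have no common factor.
\<close>

definition id_rule :: "'n::finite rule" where
  "id_rule = ({0}, \<lambda>j. Var (0, j))"

fun iterate_rule :: "'n::finite rule \<Rightarrow> nat \<Rightarrow> 'n rule" where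
  "iterate_rule R 0 = id_rule"
| "iterate_rule R (Suc m) = compose_rule R (iterate_rule R m)"

text \<open>
  \<^term>\<open>iterate_rule R (Suc m)\<close> is meaningful only if this composition exists.
\<close>

definition iterable :: "'n::finite rule \<Rightarrow> bool" where
  "iterable R \<longleftrightarrow> (\<forall>m. composable R (iterate_rule R m))"

definition total_deg :: "('n \<Rightarrow> 'n cpoly) \<Rightarrow> nat" where
  "total_deg F =
     Max ((\<lambda>m. \<Sum>x\<in>Poly_Mapping.keys m. Poly_Mapping.lookup m x) ` (\<Union>j. Poly_Mapping.keys (F j)))"

text \<open>
  A lattice map is a partial map of configurations which has a local rule \<open>R\<close>. Such an \<open>R\<close> is
  unique up to a constant factor in the polynomials and unused positions in the neighborhood;
  neither affects iterability or degrees, so the choice of \<open>R\<close> does not matter.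
\<close>

definition has_dynamical_degree :: "('n::finite config \<rightharpoonup> 'n config) \<Rightarrow> real \<Rightarrow> bool" where
  "has_dynamical_degree T l \<longleftrightarrow>
     (\<exists>R. local_rule R \<and> lattice_map R = T \<and> iterable R \<and>
        (\<lambda>m. root m (real (total_deg (snd (iterate_rule R m))))) \<longlonglongrightarrow> l)"


section \<open>The skew pentagram map\<close>

definition skew_pentagram :: "int \<Rightarrow> int \<Rightarrow> int \<Rightarrow> int \<Rightarrow> (3 config \<rightharpoonup> 3 config)" where
  "skew_pentagram a b c d v =
     (if \<forall>i. v (i + a) \<noteq> v (i + b) \<and> v (i + c) \<noteq> v (i + d) \<and>
             proj_line (v (i + a)) (v (i + b)) \<noteq> proj_line (v (i + c)) (v (i + d))
      then Some (\<lambda>i. THE p. p \<in> proj_line (v (i + a)) (v (i + b)) \<inter> proj_line (v (i + c)) (v (i + d)))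
      else None)"

end

theory Submission
  imports
    Defs
    "HOL-Analysis.Cartesian_Space"
    "HOL-Computational_Algebra.Primes"
    "HOL-Computational_Algebra.Fundamental_Theorem_Algebra"
begin

text \<open>
  Each point enters the rule \<open>(v\<^sub>a \<times> v\<^sub>b) \<times> (v\<^sub>c \<times>
  v\<^sub>d)\<close> linearly, so the rule has degree 4, and the uncancelled \<open>m\<close>-th
  iterate has degree \<open>4\<^sup>m\<close>. The point is that no iterate acquires a common
  factor. To see this it suffices to exhibit one family of configurations whose orbits stay away
  from the indeterminacy.

  Such a family comes from the Hesse pencil \<open>x\<^sup>3 + y\<^sup>3 + z\<^sup>3 = 3 \<lambda>
  x y z\<close>. On a smooth member \<open>E\<close>, with a flex as origin, three points are
  collinear iff their sum is zero. Identify the 3-torsion of \<open>E\<close> with the field of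
  nine elements, let \<open>\<omega>\<close> satisfy \<open>\<omega>\<^sup>2 = \<omega> +
  1\<close> there (so \<open>\<omega>\<close> generates the multiplicative group, of order 8), and
  put \<open>v\<^sub>i = P + \<omega>\<^sup>i\<close>. This depends on \<open>i\<close> modulo 8
  only, so the map sends it to the configuration of the points at which the chord through
  \<open>v\<^sub>i\<close>, \<open>v\<^sub>i\<^sub>+\<^sub>2\<close> meets the chord through
  \<open>v\<^sub>i\<^sub>+\<^sub>1\<close>, \<open>v\<^sub>i\<^sub>+\<^sub>4\<close>. Since
  \<open>1 + \<omega>\<^sup>2 = \<omega> + \<omega>\<^sup>4 = - \<omega>\<^sup>3\<close>, both
  chords pass through the point \<open>- 2 P + \<omega>\<^bsup>i + 3\<^esup>\<close> of
  \<open>E\<close>. So the map acts on these configurations by \<open>P \<mapsto> - 2 P\<close>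
  and a shift of indices by 3.

  Translations by 3-torsion points are linear maps of the plane that are the same for all members
  of the pencil, and \<open>P \<mapsto> - 2 P\<close> is given by forms of degree 4. Hence the
  above becomes the polynomial identity \<open>skew_hesse\<close>, valid for every vector
  \<open>P\<close>. The map \<open>P \<mapsto> - 2 P\<close> is undefined exactly at the twelve
  vertices of the four triangles in the pencil, and it sends no other point to a vertex
  (\<open>tangential_vertex\<close>). So all iterates are nonzero on a projective line of
  configurations that avoids the vertices (\<open>plane_misses_vertices\<close>). A common factor
  of homogeneous polynomials that does not vanish on such a line is constant
  (\<open>common_factor_constant\<close>), whence the degree of the \<open>m\<close>-th iterate is
  exactly \<open>4\<^sup>m\<close>.
\<close>
section \<open>Substitution homomorphisms\<close>

definition eval_monom :: "('v \<Rightarrow> 'r::comm_semiring_1) \<Rightarrow> ('v \<Rightarrow>\<^sub>0 nat) \<Rightarrow> 'r" where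
  "eval_monom f m = (\<Prod>x\<in>Poly_Mapping.keys m. f x ^ Poly_Mapping.lookup m x)"

lemma eval_monom_superset:
  assumes "finite X" "Poly_Mapping.keys m \<subseteq> X"
  shows "eval_monom f m = (\<Prod>x\<in>X. f x ^ Poly_Mapping.lookup m x)"
  unfolding eval_monom_def
  by (rule prod.mono_neutral_left[OF assms]) (auto simp: in_keys_iff)

lemma eval_monom_0 [simp]: "eval_monom f 0 = 1"
  by (simp add: eval_monom_def)

lemma eval_monom_add: "eval_monom f (m + n) = eval_monom f m * eval_monom f n"
proof -
  let ?X = "Poly_Mapping.keys m \<union> Poly_Mapping.keys n"
  have "Poly_Mapping.keys (m + n) \<subseteq> ?X" by (rule keys_add)
  then show ?thesis
    by (simp add: eval_monom_superset[of ?X] lookup_add power_add prod.distrib)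
qed

lemma eval_monom_single [simp]: "eval_monom f (Poly_Mapping.single x n) = f x ^ n"
  by (simp add: eval_monom_def)

lemma sum_monomials:
  "(\<Sum>m\<in>Poly_Mapping.keys p. Poly_Mapping.single m (Poly_Mapping.lookup p m)) = p"
  by (rule poly_mapping_eqI)
     (auto simp: lookup_sum lookup_single when_def in_keys_iff sum.delta)

locale coeff_hom =
  fixes \<iota> :: "complex \<Rightarrow> 'r::comm_semiring_1"
  assumes zero: "\<iota> 0 = 0" and one: "\<iota> 1 = 1"
    and add: "\<iota> (x + y) = \<iota> x + \<iota> y" and mult: "\<iota> (x * y) = \<iota> x * \<iota> y"
begin

lemma poly_hom_superset:
  fixes p :: "'n cpoly"
  assumes "finite A" "Poly_Mapping.keys p \<subseteq> A"
  shows "poly_hom \<iota> f p = (\<Sum>m\<in>A. \<iota> (Poly_Mapping.lookup p m) * eval_monom f m)"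
  unfolding poly_hom_def eval_monom_def[symmetric]
  by (rule sum.mono_neutral_left[OF assms]) (auto simp: in_keys_iff zero)

lemma poly_hom_0 [simp]: "poly_hom \<iota> f 0 = 0"
  by (simp add: poly_hom_def)

lemma poly_hom_single [simp]:
  "poly_hom \<iota> f (Poly_Mapping.single m c) = \<iota> c * eval_monom f m"
  by (subst poly_hom_superset[of "{m}"]) auto

lemma poly_hom_Const [simp]: "poly_hom \<iota> f (Const c) = \<iota> c"
  by (simp add: Const_def)

lemma poly_hom_Var [simp]: "poly_hom \<iota> f (Var x) = f x"
  by (simp add: Var_def one)

lemma poly_hom_1 [simp]: "poly_hom \<iota> f 1 = 1"
  using poly_hom_Const[of f 1] by (simp add: Const_def one)

lemma poly_hom_add [simp]: "poly_hom \<iota> f (p + q) = poly_hom \<iota> f p + poly_hom \<iota> f q"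
proof -
  let ?A = "Poly_Mapping.keys p \<union> Poly_Mapping.keys q"
  have "Poly_Mapping.keys (p + q) \<subseteq> ?A" by (rule keys_add)
  then show ?thesis
    by (simp add: poly_hom_superset[of ?A] lookup_add add algebra_simps sum.distrib)
qed

lemma poly_hom_sum [simp]: "poly_hom \<iota> f (\<Sum>i\<in>I. p i) = (\<Sum>i\<in>I. poly_hom \<iota> f (p i))"
  by (induction I rule: infinite_finite_induct) auto

lemma poly_hom_mult [simp]: "poly_hom \<iota> f (p * q) = poly_hom \<iota> f p * poly_hom \<iota> f q"
proof -
  let ?P = "Poly_Mapping.keys p" and ?Q = "Poly_Mapping.keys q"
  let ?p = "Poly_Mapping.lookup p" and ?q = "Poly_Mapping.lookup q"
  have "p * q = (\<Sum>m\<in>?P. \<Sum>n\<in>?Q. Poly_Mapping.single m (?p m) * Poly_Mapping.single n (?q n))"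
    by (simp add: sum_product[symmetric] sum_monomials)
  also have "poly_hom \<iota> f \<dots>
      = (\<Sum>m\<in>?P. \<Sum>n\<in>?Q. (\<iota> (?p m) * eval_monom f m) * (\<iota> (?q n) * eval_monom f n))"
    by (simp add: mult_single mult eval_monom_add mult_ac)
  also have "\<dots> = poly_hom \<iota> f p * poly_hom \<iota> f q"
    by (simp add: sum_product[symmetric] poly_hom_def eval_monom_def)
  finally show ?thesis .
qed

lemma poly_hom_prod [simp]: "poly_hom \<iota> f (\<Prod>i\<in>I. p i) = (\<Prod>i\<in>I. poly_hom \<iota> f (p i))"
  by (induction I rule: infinite_finite_induct) auto

lemma poly_hom_power [simp]: "poly_hom \<iota> f (p ^ k) = poly_hom \<iota> f p ^ k"
  by (induction k) auto

lemma poly_hom_compose: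
  "poly_hom \<iota> f (poly_hom Const g p) = poly_hom \<iota> (\<lambda>x. poly_hom \<iota> f (g x)) p"
  by (simp add: poly_hom_def[of Const] poly_hom_def[of \<iota> _ p])

end

lemma coeff_hom_diff:
  fixes \<iota> :: "complex \<Rightarrow> 'r::comm_ring_1"
  assumes "coeff_hom \<iota>"
  shows "poly_hom \<iota> f (p - q) = poly_hom \<iota> f p - poly_hom \<iota> f q"
proof -
  interpret coeff_hom \<iota> by fact
  have "poly_hom \<iota> f (p - q) + poly_hom \<iota> f q = poly_hom \<iota> f p"
    by (simp flip: poly_hom_add)
  then show ?thesis by (simp add: algebra_simps)
qed

definition eval :: "(int \<Rightarrow> 'n \<Rightarrow> complex) \<Rightarrow> 'n cpoly \<Rightarrow> complex" where
  "eval e = poly_hom id (\<lambda>(s, j). e s j)"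

interpretation id: coeff_hom id
  by unfold_locales auto

interpretation Const: coeff_hom Const
  by unfold_locales (auto simp: Const_def single_add mult_single single_one)

lemma eval_simps [simp]:
  "eval e 0 = 0" "eval e 1 = 1" "eval e (Const c) = c" "eval e (Var (s, j)) = e s j"
  "eval e (p + q) = eval e p + eval e q" "eval e (p * q) = eval e p * eval e q"
  "eval e (p - q) = eval e p - eval e q"
  by (simp_all add: eval_def coeff_hom_diff id.coeff_hom_axioms)

lemma eval_poly_hom:
  "eval e (poly_hom Const (\<lambda>(s, j). g s j) p) = eval (\<lambda>s j. eval e (g s j)) p"
  unfolding eval_def id.poly_hom_compose by (rule arg_cong2[where f = "poly_hom id"]) auto

lemma eval_shift_poly: "eval e (shift_poly k p) = eval (\<lambda>s. e (s + k)) p"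
  by (simp add: shift_poly_def eval_poly_hom)

text \<open>
  Restriction of a polynomial to an affine line gives a polynomial in one variable. This reduces
  statements on several variables to the fundamental theorem of algebra.
\<close>

lemma eval_line_poly: "\<exists>P. \<forall>t. poly P t = eval (\<lambda>s j. u s j + t * w s j) p"
proof (intro exI allI)
  fix t
  show "poly (poly_hom (\<lambda>c. [:c:]) (\<lambda>(s, j). [:u s j, w s j:]) p) t
      = eval (\<lambda>s j. u s j + t * w s j) p"
    by (simp add: eval_def poly_hom_def poly_sum poly_prod case_prod_unfold)
qed

section \<open>Polynomials are determined by their values\<close>

text \<open>
  Unique factorization: at distinct primes, distinct monomials take distinct values.
\<close>

lemma eval_monom_prime_inj:
  fixes \<pi> :: "'v \<Rightarrow> nat"
  assumes "inj \<pi>" "\<And>x. prime (\<pi> x)" "eval_monom \<pi> m = eval_monom \<pi> n"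
  shows "m = n"
proof (rule poly_mapping_eqI)
  fix x
  have *: "multiplicity (\<pi> x) (eval_monom \<pi> m) = Poly_Mapping.lookup m x" for m
  proof -
    have "eval_monom \<pi> m = (\<Prod>p\<in>\<pi> ` Poly_Mapping.keys m. p ^ Poly_Mapping.lookup m (inv \<pi> p))"
      using assms(1) by (simp add: eval_monom_def prod.reindex inj_on_subset inv_f_f o_def)
    also have "multiplicity (\<pi> x) \<dots> = Poly_Mapping.lookup m x"
      using assms by (subst multiplicity_prod_prime_powers)
        (auto simp: inv_f_f in_keys_iff dest: injD)
    finally show ?thesis .
  qed
  show "Poly_Mapping.lookup m x = Poly_Mapping.lookup n x"
    using *[of m] *[of n] assms(3) by simp
qed

text \<open>
  At the \<open>k\<close>-th powers of distinct primes, the values of the monomials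
  \<open>m\<close> are \<open>M m ^ k\<close> with pairwise distinct \<open>M m\<close>. If all
  these evaluations vanish, then so does every combination of them, that is, the sum of
  \<open>lookup p m * poly q (M m)\<close> for any \<open>q\<close> in one variable. A Lagrange
  polynomial \<open>q\<close> isolates one coefficient.
\<close>

lemma poly_vanishing_everywhere:
  fixes p :: "'n::finite cpoly"
  assumes "\<And>e. eval e p = 0"
  shows "p = 0"
proof (rule ccontr)
  assume "p \<noteq> 0"
  then obtain m0 where m0: "m0 \<in> Poly_Mapping.keys p"
    by (metis all_not_in_conv keys_eq_empty)
  define \<pi> where "\<pi> x = enumerate {q::nat. prime q} (to_nat (x :: int \<times> 'n))" for x
  have inj: "inj \<pi>"
    unfolding \<pi>_def
    by (intro injI) (metis enumerate_mono_iff linorder_neqE_nat less_irrefl primes_infinite to_nat_split)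
  have pr: "prime (\<pi> x)" for x
    using enumerate_in_set[OF primes_infinite] by (simp add: \<pi>_def)
  define M where "M m = (of_nat (eval_monom \<pi> m) :: complex)" for m
  have M_inj: "M m = M n \<longleftrightarrow> m = n" for m n
    using eval_monom_prime_inj[OF inj pr] by (auto simp: M_def)
  have power_sums: "(\<Sum>m\<in>Poly_Mapping.keys p. Poly_Mapping.lookup p m * M m ^ k) = 0" for k
  proof -
    have "eval (\<lambda>s j. of_nat (\<pi> (s, j)) ^ k) p
        = (\<Sum>m\<in>Poly_Mapping.keys p. Poly_Mapping.lookup p m * M m ^ k)"
      by (simp add: eval_def poly_hom_def M_def eval_monom_def case_prod_unfold
          prod_power_distrib mult.commute flip: power_mult)
    then show ?thesis using assms by simp
  qed
  have test: "(\<Sum>m\<in>Poly_Mapping.keys p. Poly_Mapping.lookup p m * poly q (M m)) = 0" for q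
  proof -
    have "(\<Sum>m\<in>Poly_Mapping.keys p. Poly_Mapping.lookup p m * poly q (M m))
        = (\<Sum>k\<le>degree q. coeff q k * (\<Sum>m\<in>Poly_Mapping.keys p. Poly_Mapping.lookup p m * M m ^ k))"
      by (simp add: poly_altdef sum_distrib_left mult_ac sum.swap[of _ "Poly_Mapping.keys p"])
    then show ?thesis by (simp add: power_sums)
  qed
  define q where "q = (\<Prod>m\<in>Poly_Mapping.keys p - {m0}. [:- M m, 1:])"
  have q: "poly q (M m) = 0 \<longleftrightarrow> m \<noteq> m0" if "m \<in> Poly_Mapping.keys p" for m
    using that by (auto simp: q_def poly_prod M_inj)
  have "(\<Sum>m\<in>Poly_Mapping.keys p. Poly_Mapping.lookup p m * poly q (M m))
      = Poly_Mapping.lookup p m0 * poly q (M m0)"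
    using m0 q by (subst sum.remove[OF _ m0]) (auto intro!: sum.neutral)
  then show False
    using test[of q] q[OF m0] m0 by (simp add: in_keys_iff)
qed

section \<open>Homogeneity with respect to a grading\<close>

text \<open>
  The grading is a parameter, because both the total degree and the degree in the coordinates of a
  single point are needed.
\<close>

definition homogeneous :: "(('v \<Rightarrow>\<^sub>0 nat) \<Rightarrow> nat) \<Rightarrow> nat \<Rightarrow> (('v \<Rightarrow>\<^sub>0 nat) \<Rightarrow>\<^sub>0 complex) \<Rightarrow> bool" where
  "homogeneous w d p \<longleftrightarrow> (\<forall>m\<in>Poly_Mapping.keys p. w m = d)"

locale grading =
  fixes w :: "('v \<Rightarrow>\<^sub>0 nat) \<Rightarrow> nat"
  assumes weight_add: "w (m + n) = w m + w n"
begin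

lemma weight_0: "w 0 = 0"
  using weight_add[of 0 0] by simp

lemma homogeneous_0: "homogeneous w d 0"
  by (simp add: homogeneous_def)

lemma homogeneous_single: "w m = d \<Longrightarrow> homogeneous w d (Poly_Mapping.single m c)"
  by (simp add: homogeneous_def)

lemma homogeneous_1: "homogeneous w 0 1"
  using homogeneous_single[of 0 0 1] weight_0 by simp

lemma homogeneous_add:
  "homogeneous w d p \<Longrightarrow> homogeneous w d q \<Longrightarrow> homogeneous w d (p + q)"
  using keys_add[of p q] by (auto simp: homogeneous_def)

lemma homogeneous_diff:
  "homogeneous w d p \<Longrightarrow> homogeneous w d q \<Longrightarrow> homogeneous w d (p - q)"
  using keys_diff[of p q] by (auto simp: homogeneous_def)

lemma homogeneous_sum:
  "(\<And>i. i \<in> I \<Longrightarrow> homogeneous w d (p i)) \<Longrightarrow> homogeneous w d (\<Sum>i\<in>I. p i)"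
  by (induction I rule: infinite_finite_induct) (auto intro: homogeneous_0 homogeneous_add)

lemma homogeneous_mult:
  "homogeneous w d p \<Longrightarrow> homogeneous w k q \<Longrightarrow> homogeneous w (d + k) (p * q)"
  using keys_mult[of p q] by (fastforce simp: homogeneous_def weight_add)

lemma homogeneous_prod:
  "(\<And>i. i \<in> I \<Longrightarrow> homogeneous w (d i) (p i)) \<Longrightarrow>
    homogeneous w (\<Sum>i\<in>I. d i) (\<Prod>i\<in>I. p i)"
  by (induction I rule: infinite_finite_induct) (auto intro: homogeneous_1 homogeneous_mult)

lemma homogeneous_power: "homogeneous w d p \<Longrightarrow> homogeneous w (k * d) (p ^ k)"
  by (induction k) (auto intro: homogeneous_1 homogeneous_mult)

end

definition monom_degree :: "('v \<Rightarrow>\<^sub>0 nat) \<Rightarrow> nat" where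
  "monom_degree m = (\<Sum>x\<in>Poly_Mapping.keys m. Poly_Mapping.lookup m x)"

lemma monom_degree_superset:
  assumes "finite X" "Poly_Mapping.keys m \<subseteq> X"
  shows "monom_degree m = (\<Sum>x\<in>X. Poly_Mapping.lookup m x)"
  unfolding monom_degree_def
  by (rule sum.mono_neutral_left[OF assms]) (auto simp: in_keys_iff)

interpretation total: grading monom_degree
proof
  fix m n :: "'v \<Rightarrow>\<^sub>0 nat"
  let ?X = "Poly_Mapping.keys m \<union> Poly_Mapping.keys n"
  have "Poly_Mapping.keys (m + n) \<subseteq> ?X" by (rule keys_add)
  then show "monom_degree (m + n) = monom_degree m + monom_degree n"
    by (simp add: monom_degree_superset[of ?X] lookup_add sum.distrib)
qed

lemma homogeneous_Const: "homogeneous monom_degree 0 (Const c)"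
  unfolding Const_def by (rule total.homogeneous_single[OF total.weight_0])

lemma homogeneous_Var: "homogeneous monom_degree 1 (Var x)"
  unfolding Var_def by (rule total.homogeneous_single) (simp add: monom_degree_def)

lemma homogeneous_poly_hom:
  fixes p :: "'n cpoly"
  assumes "homogeneous monom_degree d p" "\<And>x. homogeneous monom_degree k (g x)"
  shows "homogeneous monom_degree (d * k) (poly_hom Const g p)"
  unfolding poly_hom_def
proof (rule total.homogeneous_sum)
  fix m assume m: "m \<in> Poly_Mapping.keys p"
  have "homogeneous monom_degree (\<Sum>x\<in>Poly_Mapping.keys m. Poly_Mapping.lookup m x * k)
      (\<Prod>x\<in>Poly_Mapping.keys m. g x ^ Poly_Mapping.lookup m x)"
    by (intro total.homogeneous_prod total.homogeneous_power assms)
  also have "(\<Sum>x\<in>Poly_Mapping.keys m. Poly_Mapping.lookup m x * k) = d * k"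
    using assms(1) m by (simp add: homogeneous_def monom_degree_def flip: sum_distrib_right)
  finally show "homogeneous monom_degree (d * k) (Const (Poly_Mapping.lookup p m) *
      (\<Prod>x\<in>Poly_Mapping.keys m. g x ^ Poly_Mapping.lookup m x))"
    using total.homogeneous_mult[OF homogeneous_Const] by fastforce
qed

lemma homogeneous_shift_poly:
  assumes "homogeneous monom_degree d p"
  shows "homogeneous monom_degree d (shift_poly k p)"
proof -
  have "homogeneous monom_degree (d * 1) (poly_hom Const (\<lambda>(s, j). Var (s + k, j)) p)"
    by (rule homogeneous_poly_hom[OF assms]) (simp only: case_prod_unfold homogeneous_Var)
  then show ?thesis by (simp add: shift_poly_def)
qed

lemma total_deg_homogeneous:
  fixes F :: "'n::finite \<Rightarrow> 'n cpoly"
  assumes "\<And>j. homogeneous monom_degree d (F j)" "F j0 \<noteq> 0"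
  shows "total_deg F = d"
proof -
  have "monom_degree ` (\<Union>j. Poly_Mapping.keys (F j)) = {d}"
    using assms by (fastforce simp: homogeneous_def image_iff simp flip: keys_eq_empty)
  then show ?thesis
    by (simp add: total_deg_def monom_degree_def)
qed

interpretation site: grading "\<lambda>m. \<Sum>j\<in>UNIV. Poly_Mapping.lookup m (s, j :: 'n::finite)" for s :: int
  by unfold_locales (simp add: lookup_add sum.distrib)

lemma multihomogeneous_iff:
  "multihomogeneous \<delta> p \<longleftrightarrow>
    (\<forall>s. homogeneous (\<lambda>m. \<Sum>j\<in>UNIV. Poly_Mapping.lookup m (s, j)) (\<delta> s) p)"
  by (auto simp: multihomogeneous_def homogeneous_def)

lemma multihomogeneous_Var:
  "multihomogeneous (\<lambda>t. if t = s then 1 else 0) (Var (s, j))"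
  by (auto simp: multihomogeneous_def Var_def lookup_single when_def)

lemma multihomogeneous_mult:
  "multihomogeneous \<delta> p \<Longrightarrow> multihomogeneous \<epsilon> q \<Longrightarrow>
    multihomogeneous (\<lambda>s. \<delta> s + \<epsilon> s) (p * q)"
  by (auto simp: multihomogeneous_iff intro: site.homogeneous_mult)

lemma multihomogeneous_diff:
  "multihomogeneous \<delta> p \<Longrightarrow> multihomogeneous \<delta> q \<Longrightarrow> multihomogeneous \<delta> (p - q)"
  by (auto simp: multihomogeneous_iff intro: site.homogeneous_diff)

section \<open>Common factors that miss a plane\<close>

lemma eval_homogeneous:
  fixes p :: "'n cpoly"
  assumes "homogeneous monom_degree d p"
  shows "eval (\<lambda>s j. t * e s j) p = t ^ d * eval e p"
proof -
  have "(\<Prod>x\<in>Poly_Mapping.keys m. (case x of (s, j) \<Rightarrow> t * e s j) ^ Poly_Mapping.lookup m x)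
      = t ^ d * (\<Prod>x\<in>Poly_Mapping.keys m. (case x of (s, j) \<Rightarrow> e s j) ^ Poly_Mapping.lookup m x)"
    if "m \<in> Poly_Mapping.keys p" for m
    using assms that
    by (simp add: homogeneous_def monom_degree_def case_prod_unfold power_mult_distrib
        prod.distrib flip: power_sum)
  then show ?thesis
    by (simp add: eval_def poly_hom_def sum_distrib_left mult_ac)
qed

lemma poly_eq_off_zeros:
  fixes P Q R :: "complex poly"
  assumes "R \<noteq> 0" "\<And>t. poly R t \<noteq> 0 \<Longrightarrow> poly P t = poly Q t"
  shows "P = Q"
proof -
  have "poly ((P - Q) * R) t = poly 0 t" for t
    using assms(2)[of t] by auto
  then have "(P - Q) * R = 0" by (metis poly_eq_poly_eq_iff ext)
  with assms(1) show ?thesis by simp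
qed

text \<open>
  A polynomial in one variable without complex zeros is constant.
\<close>

lemma eval_constant_on_line:
  fixes p :: "'n cpoly"
  assumes "\<And>t. eval (\<lambda>s j. u s j + t * w s j) p \<noteq> 0"
  shows "eval (\<lambda>s j. u s j + t * w s j) p = eval u p"
proof -
  obtain P where P: "\<And>t. poly P t = eval (\<lambda>s j. u s j + t * w s j) p"
    using eval_line_poly[of u w p] by blast
  then have "constant (poly P)"
    using fundamental_theorem_of_algebra[of P] assms by metis
  then have "poly P t = poly P 0" by (metis constant_def)
  then show ?thesis by (simp add: P)
qed

lemma eval_constant_off_zeros:
  fixes p q :: "'n cpoly"
  assumes "eval e0 q \<noteq> 0" "\<And>e. eval e q \<noteq> 0 \<Longrightarrow> eval e p = h"
  shows "eval e p = h"
proof -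
  obtain P where P: "\<And>t. poly P t = eval (\<lambda>s j. e s j + t * (e0 s j - e s j)) p"
    using eval_line_poly[of e "\<lambda>s j. e0 s j - e s j" p] by blast
  obtain Q where Q: "\<And>t. poly Q t = eval (\<lambda>s j. e s j + t * (e0 s j - e s j)) q"
    using eval_line_poly[of e "\<lambda>s j. e0 s j - e s j" q] by blast
  have "poly Q 1 \<noteq> 0" using assms(1) by (simp add: Q)
  then have "Q \<noteq> 0" by auto
  then have "P = [:h:]"
    by (rule poly_eq_off_zeros) (simp add: P Q assms(2))
  then show ?thesis using P[of 0] by simp
qed

text \<open>
  For every \<open>x \<noteq> 0\<close> the line through \<open>x u\<close> in direction
  \<open>w\<close> and the line through \<open>w\<close> in direction \<open>u\<close> avoid the
  zeros of \<open>H\<close>, so \<open>H\<close> is constant on both; as they meet,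
  \<open>H\<close> has the same value \<open>h\<close> at \<open>x u\<close> as at
  \<open>w\<close>. Letting \<open>x\<close> tend to 0, it has that value at the origin too, so
  \<open>H\<close> does not vanish there. On the ray through a point \<open>e\<close> with
  \<open>G\<^sub>l(e) \<noteq> 0\<close>, homogeneity gives \<open>G\<^sub>l(t e) = t\<^sup>d
  G\<^sub>l(e)\<close>, so its divisor \<open>H\<close> has no zero for \<open>t \<noteq>
  0\<close>, nor at the origin, and is again constant. Thus \<open>H = h\<close> off the zeros of
  \<open>G\<^sub>l\<close>, hence everywhere.
\<close>

lemma common_factor_constant:
  fixes G :: "'m \<Rightarrow> 'n::finite cpoly"
  assumes homog: "\<And>l. homogeneous monom_degree d (G l)"
    and plane: "\<And>x y. x \<noteq> 0 \<or> y \<noteq> 0 \<Longrightarrow> \<exists>l. eval (\<lambda>s j. x * u s j + y * w s j) (G l) \<noteq> 0"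
    and dvd: "\<And>l. H dvd G l"
  shows "\<exists>h. h \<noteq> 0 \<and> H = Const h"
proof -
  have nz: "eval e H \<noteq> 0" if "eval e (G l) \<noteq> 0" for e l
    using dvd[of l] that by (auto elim!: dvdE)
  have plane_nz: "eval (\<lambda>s j. x * u s j + y * w s j) H \<noteq> 0" if "x \<noteq> 0 \<or> y \<noteq> 0" for x y
    using plane[OF that] nz by blast
  define h where "h = eval w H"
  have h: "h \<noteq> 0" using plane_nz[of 0 1] by (simp add: h_def)
  have ray: "eval (\<lambda>s j. x * u s j) H = h" if x: "x \<noteq> 0" for x
  proof -
    have "eval (\<lambda>s j. x * u s j) H = eval (\<lambda>s j. x * u s j + 1 * w s j) H"
      by (rule eval_constant_on_line[symmetric]) (use plane_nz x in auto)
    also have "\<dots> = eval (\<lambda>s j. w s j + x * u s j) H" by (simp add: add.commute)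
    also have "\<dots> = h" unfolding h_def
      by (rule eval_constant_on_line) (use plane_nz[where y = 1] in \<open>auto simp: add.commute\<close>)
    finally show ?thesis .
  qed
  have origin: "eval (\<lambda>s j. 0) H = h"
  proof -
    obtain P where P: "\<And>t. poly P t = eval (\<lambda>s j. 0 + t * u s j) H"
      using eval_line_poly[of "\<lambda>s j. 0" u H] by blast
    have "P = [:h:]"
      by (rule poly_eq_off_zeros[of "[:0, 1:]"]) (auto simp: P ray)
    then show ?thesis using P[of 0] by simp
  qed
  have generic: "eval e H = h" if e: "eval e (G l) \<noteq> 0" for e l
  proof -
    have "eval (\<lambda>s j. 0 + t * e s j) H \<noteq> 0" for t
    proof (cases "t = 0")
      case False
      then show ?thesis
        using nz[of "\<lambda>s j. t * e s j" l] e by (simp add: eval_homogeneous[OF homog])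
    qed (simp add: origin h)
    from eval_constant_on_line[OF this, of 1] show ?thesis by (simp add: origin)
  qed
  obtain l0 where l0: "eval u (G l0) \<noteq> 0"
    using plane[of 1 0] by auto
  have "eval e H = h" for e
    by (rule eval_constant_off_zeros[OF l0]) (rule generic)
  then have "eval e (H - Const h) = 0" for e by simp
  then have "H - Const h = 0" by (rule poly_vanishing_everywhere)
  with h show ?thesis by auto
qed

lemma Const_unit: "h \<noteq> 0 \<Longrightarrow> Const h dvd (1 :: 'n cpoly)"
  by (rule dvdI[of _ _ "Const (1 / h)"]) (simp add: Const.one flip: Const.mult)

text \<open>
  The choice in \<open>cancel_common\<close> is harmless if there is nothing to cancel: it can
  only rescale the tuple.
\<close>

lemma cancel_common_trivial:
  fixes F :: "'n::finite \<Rightarrow> 'n cpoly"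
  assumes "\<And>H. (\<And>j. H dvd F j) \<Longrightarrow> \<exists>h. h \<noteq> 0 \<and> H = Const h"
  obtains h where "h \<noteq> 0" "\<And>j. cancel_common F j = Const h * F j"
proof -
  have ncf: "no_common_factor F"
    unfolding no_common_factor_def using assms Const_unit by metis
  have "\<exists>G. (\<exists>H. \<forall>j. F j = H * G j) \<and> no_common_factor G"
    using ncf by (intro exI[of _ F]) (auto intro: exI[of _ 1])
  then have "\<exists>H. \<forall>j. F j = H * cancel_common F j"
    unfolding cancel_common_def by (rule someI2_ex) blast
  then obtain H where H: "\<And>j. F j = H * cancel_common F j" by blast
  then obtain k where k: "k \<noteq> 0" "H = Const k"
    using assms[of H] by (metis dvd_triv_left)
  have "cancel_common F j = Const (1 / k) * F j" for j
    using k by (simp add: H[of j] Const.one flip: mult.assoc Const.mult)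
  with k show ?thesis by (intro that[of "1 / k"]) auto
qed

section \<open>The skew pentagram map in homogeneous coordinates\<close>

lemma fun3_eqI: "f 1 = g 1 \<Longrightarrow> f 2 = g 2 \<Longrightarrow> f 3 = g 3 \<Longrightarrow> f = (g :: 3 \<Rightarrow> 'a)"
  by (rule ext) (metis exhaust_3)

definition triple :: "'a \<Rightarrow> 'a \<Rightarrow> 'a \<Rightarrow> 3 \<Rightarrow> 'a" where
  "triple x y z j = (if j = 1 then x else if j = 2 then y else z)"

lemma triple_simps [simp]: "triple x y z 1 = x" "triple x y z 2 = y" "triple x y z 3 = z"
  by (simp_all add: triple_def)

definition cross :: "(3 \<Rightarrow> 'a::comm_ring_1) \<Rightarrow> (3 \<Rightarrow> 'a) \<Rightarrow> 3 \<Rightarrow> 'a" where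
  "cross p q = triple (p 2 * q 3 - p 3 * q 2) (p 3 * q 1 - p 1 * q 3) (p 1 * q 2 - p 2 * q 1)"

definition dot :: "(3 \<Rightarrow> 'a::comm_ring_1) \<Rightarrow> (3 \<Rightarrow> 'a) \<Rightarrow> 'a" where
  "dot p q = p 1 * q 1 + p 2 * q 2 + p 3 * q 3"

lemma cross_simps:
  "cross p q 1 = p 2 * q 3 - p 3 * q 2"
  "cross p q 2 = p 3 * q 1 - p 1 * q 3"
  "cross p q 3 = p 1 * q 2 - p 2 * q 1"
  by (simp_all add: cross_def)

lemma cross_scale: "cross (\<lambda>j. x * p j) (\<lambda>j. y * q j) = (\<lambda>j. x * y * cross p q j)"
  by (rule fun3_eqI) (simp_all add: cross_def algebra_simps)

text \<open>
  Coordinates are taken in an arbitrary ring, so that the same formula describes both the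
  polynomials of the rule (coordinates are variables) and their values (coordinates are numbers).
\<close>

definition skew_step :: "int \<Rightarrow> int \<Rightarrow> int \<Rightarrow> int \<Rightarrow>
    (int \<Rightarrow> 3 \<Rightarrow> 'a::comm_ring_1) \<Rightarrow> int \<Rightarrow> 3 \<Rightarrow> 'a" where
  "skew_step a b c d e i = cross (cross (e (i + a)) (e (i + b))) (cross (e (i + c)) (e (i + d)))"

definition skew_rule :: "int \<Rightarrow> int \<Rightarrow> int \<Rightarrow> int \<Rightarrow> 3 rule" where
  "skew_rule a b c d = ({a, b, c, d}, skew_step a b c d (\<lambda>s j. Var (s, j)) 0)"

lemma eval_skew_rule: "eval e (snd (skew_rule a b c d) j) = skew_step a b c d e 0 j"
  by (simp add: skew_rule_def skew_step_def cross_def triple_def)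

lemma skew_step_scale:
  "skew_step a b c d (\<lambda>i j. \<gamma> i * e i j)
    = (\<lambda>i j. \<gamma> (i + a) * \<gamma> (i + b) * (\<gamma> (i + c) * \<gamma> (i + d)) * skew_step a b c d e i j)"
  by (intro ext) (simp add: skew_step_def cross_scale)

lemma skew_step_shift:
  "(skew_step a b c d ^^ m) (\<lambda>s. e (s + k)) = (\<lambda>s. (skew_step a b c d ^^ m) e (s + k))"
  by (induction m) (auto simp: skew_step_def ac_simps)

lemma homogeneous_cross:
  fixes p q :: "3 \<Rightarrow> 'n cpoly"
  assumes "\<And>j. homogeneous monom_degree k (p j)" "\<And>j. homogeneous monom_degree l (q j)"
  shows "homogeneous monom_degree (k + l) (cross p q j)"
proof -
  have "homogeneous monom_degree (k + l) (p i * q i')" for i i'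
    by (rule total.homogeneous_mult) (rule assms)+
  then show ?thesis
    by (auto simp: cross_def triple_def intro: total.homogeneous_diff)
qed

lemma homogeneous_skew_rule: "homogeneous monom_degree 4 (snd (skew_rule a b c d) j)"
proof -
  have "homogeneous monom_degree (1 + 1 + (1 + 1)) (snd (skew_rule a b c d) j)"
    unfolding skew_rule_def skew_step_def snd_conv
    by (intro homogeneous_cross homogeneous_Var)
  then show ?thesis by (simp add: eval_nat_numeral)
qed

lemma multihomogeneous_cross:
  assumes "\<And>j. multihomogeneous \<delta> (p j)" "\<And>j. multihomogeneous \<epsilon> (q j)"
  shows "multihomogeneous (\<lambda>s. \<delta> s + \<epsilon> s) (cross p q j)"
  unfolding cross_def triple_def
  by (auto intro!: multihomogeneous_diff multihomogeneous_mult assms)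

section \<open>The Hesse pencil and its translations by three-torsion points\<close>

definition \<zeta> :: complex where
  "\<zeta> = Complex (- 1 / 2) (sqrt 3 / 2)"

lemma zeta_square: "\<zeta>\<^sup>2 = - 1 - \<zeta>"
  by (simp add: \<zeta>_def complex_eq_iff power2_eq_square)

lemma zeta_mult: "\<zeta> * \<zeta> = - 1 - \<zeta>" "\<zeta> * (\<zeta> * x) = - x - \<zeta> * x"
proof -
  show *: "\<zeta> * \<zeta> = - 1 - \<zeta>" using zeta_square by (simp only: power2_eq_square)
  show "\<zeta> * (\<zeta> * x) = - x - \<zeta> * x"
    unfolding mult.assoc[symmetric] * by (simp add: left_diff_distrib)
qed

lemma zeta_nz: "\<zeta> \<noteq> 0" "1 + 2 * \<zeta> \<noteq> 0" "2 + \<zeta> \<noteq> 0"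
  by (auto simp: \<zeta>_def complex_eq_iff)

text \<open>
  For exponents \<open>p, q\<close> modulo 3, the linear map with \<open>k\<close>-th coordinate
  \<open>\<zeta>\<^bsup>q k\<^esup> x\<^bsub>k + p\<^esub>\<close> (\<open>k\<close> = 0, 1, 2)
  preserves every member of the Hesse pencil and acts on the smooth ones as the translation by a
  3-torsion point. The rows of the table are the nonzero \<open>(p, q)\<close> in the order in
  which \<open>p + q \<omega>\<close> runs through the powers of \<open>\<omega>\<close>, where
  \<open>\<omega>\<^sup>2 = \<omega> + 1\<close> over the field of three elements.
\<close>

definition hesse :: "int \<Rightarrow> (3 \<Rightarrow> complex) \<Rightarrow> 3 \<Rightarrow> complex" where
  "hesse i p = (let x = p 1; y = p 2; z = p 3 in
     [triple y z x, triple x (\<zeta> * y) (\<zeta>\<^sup>2 * z), triple y (\<zeta> * z) (\<zeta>\<^sup>2 * x),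
      triple y (\<zeta>\<^sup>2 * z) (\<zeta> * x), triple z x y, triple x (\<zeta>\<^sup>2 * y) (\<zeta> * z),
      triple z (\<zeta>\<^sup>2 * x) (\<zeta> * y), triple z (\<zeta> * x) (\<zeta>\<^sup>2 * y)] ! nat (i mod 8))"

lemma hesse_simps:
  "i mod 8 = 0 \<Longrightarrow> hesse i p = triple (p 2) (p 3) (p 1)"
  "i mod 8 = 1 \<Longrightarrow> hesse i p = triple (p 1) (\<zeta> * p 2) (\<zeta>\<^sup>2 * p 3)"
  "i mod 8 = 2 \<Longrightarrow> hesse i p = triple (p 2) (\<zeta> * p 3) (\<zeta>\<^sup>2 * p 1)"
  "i mod 8 = 3 \<Longrightarrow> hesse i p = triple (p 2) (\<zeta>\<^sup>2 * p 3) (\<zeta> * p 1)"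
  "i mod 8 = 4 \<Longrightarrow> hesse i p = triple (p 3) (p 1) (p 2)"
  "i mod 8 = 5 \<Longrightarrow> hesse i p = triple (p 1) (\<zeta>\<^sup>2 * p 2) (\<zeta> * p 3)"
  "i mod 8 = 6 \<Longrightarrow> hesse i p = triple (p 3) (\<zeta>\<^sup>2 * p 1) (\<zeta> * p 2)"
  "i mod 8 = 7 \<Longrightarrow> hesse i p = triple (p 3) (\<zeta> * p 1) (\<zeta>\<^sup>2 * p 2)"
  by (simp_all add: hesse_def Let_def)

lemma mod_8_cases:
  fixes i :: int
  obtains "i mod 8 = 0" | "i mod 8 = 1" | "i mod 8 = 2" | "i mod 8 = 3"
    | "i mod 8 = 4" | "i mod 8 = 5" | "i mod 8 = 6" | "i mod 8 = 7"
proof -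
  have "0 \<le> i mod 8" "i mod 8 < 8" by simp_all
  then show ?thesis using that by linarith
qed

lemma hesse_linear:
  "hesse i (\<lambda>j. x * p j + y * q j) = (\<lambda>j. x * hesse i p j + y * hesse i q j)"
  by (cases i rule: mod_8_cases; rule fun3_eqI) (simp_all add: hesse_simps algebra_simps)

lemma hesse_nonzero: "p j \<noteq> 0 \<Longrightarrow> \<exists>l. hesse i p l \<noteq> 0"
proof (rule ccontr)
  assume p: "p j \<noteq> 0" and "\<nexists>l. hesse i p l \<noteq> 0"
  then have "hesse i p 1 = 0" "hesse i p 2 = 0" "hesse i p 3 = 0" by auto
  then have "p 1 = 0 \<and> p 2 = 0 \<and> p 3 = 0"
    by (cases i rule: mod_8_cases) (simp_all add: hesse_simps zeta_nz)
  with p show False by (metis exhaust_3)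
qed

text \<open>
  The tangential of \<open>p\<close>: the further point at which the tangent at \<open>p\<close>
  meets the cubic of the pencil through \<open>p\<close>, that is, \<open>- 2 p\<close> in the
  group law with a flex as origin.
\<close>

definition tangential :: "(3 \<Rightarrow> complex) \<Rightarrow> 3 \<Rightarrow> complex" where
  "tangential p = triple (p 1 * (p 3 ^ 3 - p 2 ^ 3)) (p 2 * (p 1 ^ 3 - p 3 ^ 3))
     (p 3 * (p 2 ^ 3 - p 1 ^ 3))"

text \<open>
  The four triangles of the pencil have twelve vertices: the three unit points, and the nine
  points whose coordinates have equal cubes. The zero vector is counted as well, so that avoiding
  vertices includes being a point.
\<close>

definition vertex :: "(3 \<Rightarrow> complex) \<Rightarrow> bool" where
  "vertex p \<longleftrightarrow> (p 1 = 0 \<and> p 2 = 0) \<or> (p 2 = 0 \<and> p 3 = 0) \<or> (p 3 = 0 \<and> p 1 = 0) \<or>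
     (p 1 ^ 3 = p 2 ^ 3 \<and> p 2 ^ 3 = p 3 ^ 3)"

text \<open>
  Here \<open>x, y, z\<close> are the cubes of the coordinates of a point, and the hypotheses say
  that the cubes of the coordinates of its tangential agree. If \<open>k \<noteq> 0\<close>,
  eliminating \<open>x, y, z\<close> leaves conditions on the differences \<open>u, v, w\<close>,
  which have sum 0. They force the second elementary symmetric function of the differences to
  vanish, so that \<open>u, v, w\<close> are the roots of some \<open>t\<^sup>3 = const\<close>;
  then their cubes agree, against the first condition.
\<close>

lemma tangential_aux:
  fixes x y z :: complex
  assumes x: "x * (z - y) ^ 3 = k" and y: "y * (x - z) ^ 3 = k" and z: "z * (y - x) ^ 3 = k"
  shows "k = 0"
proof (rule ccontr)
  assume k: "k \<noteq> 0"
  define u v w where "u = z - y" and "v = x - z" and "w = y - x"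
  have w: "w = - u - v" by (simp add: u_def v_def w_def)
  have nz: "u \<noteq> 0" "v \<noteq> 0" "w \<noteq> 0"
    using x y z k by (auto simp: u_def v_def w_def)
  have e: "x * u ^ 3 = k" "y * v ^ 3 = k" "z * w ^ 3 = k"
    using x y z by (simp_all add: u_def v_def w_def)
  have "u * (v ^ 3 * w ^ 3) = (z * w ^ 3) * v ^ 3 - (y * v ^ 3) * w ^ 3"
    by (simp add: u_def algebra_simps)
  then have E1: "u * (v ^ 3 * w ^ 3) = k * (v ^ 3 - w ^ 3)" by (simp add: e algebra_simps)
  have "v * (w ^ 3 * u ^ 3) = (x * u ^ 3) * w ^ 3 - (z * w ^ 3) * u ^ 3"
    by (simp add: v_def algebra_simps)
  then have E2: "v * (w ^ 3 * u ^ 3) = k * (w ^ 3 - u ^ 3)" by (simp add: e algebra_simps)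
  have "w * (u ^ 3 * v ^ 3) = (y * v ^ 3) * u ^ 3 - (x * u ^ 3) * v ^ 3"
    by (simp add: w_def algebra_simps)
  then have E3: "w * (u ^ 3 * v ^ 3) = k * (u ^ 3 - v ^ 3)" by (simp add: e algebra_simps)
  have sq: "(u * v + v * w + w * u) ^ 2 = v ^ 2 * w ^ 2 + w ^ 2 * u ^ 2 + u ^ 2 * v ^ 2"
    by (simp add: w power2_eq_square algebra_simps)
  have "(u * v * w) ^ 2 * (u * v + v * w + w * u) ^ 2
      = u * v * w * (u * (v ^ 3 * w ^ 3) + v * (w ^ 3 * u ^ 3) + w * (u ^ 3 * v ^ 3))"
    unfolding sq by (simp add: power2_eq_square power3_eq_cube algebra_simps)
  also have "\<dots> = 0" unfolding E1 E2 E3 by (simp add: algebra_simps)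
  finally have sym2: "u * v + v * w + w * u = 0" using nz by simp
  have "v ^ 3 - w ^ 3 = - (v - w) * (u * v + v * w + w * u)"
    by (simp add: w power3_eq_cube algebra_simps)
  then show False using E1 sym2 nz by simp
qed

lemma vertex_aux:
  fixes x y z :: complex
  assumes "x * (z ^ 3 - y ^ 3) = 0" "y * (x ^ 3 - z ^ 3) = 0"
  shows "(x = 0 \<and> y = 0) \<or> (y = 0 \<and> z = 0) \<or> (z = 0 \<and> x = 0) \<or> (x ^ 3 = y ^ 3 \<and> y ^ 3 = z ^ 3)"
proof (cases "x = 0 \<or> y = 0")
  case True
  then show ?thesis using assms by auto
next
  case False
  then have "z ^ 3 = y ^ 3" "x ^ 3 = z ^ 3" using assms by simp_all
  then show ?thesis by metis
qed

text \<open>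
  If two coordinates of the tangential vanish, then \<open>p\<close> is a vertex; and if the cubes
  of its coordinates agree, then they all vanish. Geometrically, the tangential lies on the same
  member of the pencil as \<open>p\<close>, and a vertex lies on no member but its own triangle,
  each side of which is mapped to itself with only the vertices on it being sent to vertices or to
  nothing.
\<close>

lemma tangential_vertex:
  assumes "vertex (tangential p)"
  shows "vertex p"
proof -
  define x y z where "x = p 1" and "y = p 2" and "z = p 3"
  define A B C where "A = x * (z ^ 3 - y ^ 3)" and "B = y * (x ^ 3 - z ^ 3)"
    and "C = z * (y ^ 3 - x ^ 3)"
  have vertex: "vertex p"
    if "(x = 0 \<and> y = 0) \<or> (y = 0 \<and> z = 0) \<or> (z = 0 \<and> x = 0) \<or> (x ^ 3 = y ^ 3 \<and> y ^ 3 = z ^ 3)"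
    using that unfolding vertex_def x_def y_def z_def .
  have "(A = 0 \<and> B = 0) \<or> (B = 0 \<and> C = 0) \<or> (C = 0 \<and> A = 0) \<or> (A ^ 3 = B ^ 3 \<and> B ^ 3 = C ^ 3)"
    using assms unfolding vertex_def tangential_def triple_simps A_def B_def C_def x_def y_def z_def .
  moreover have "A = 0 \<and> B = 0" if "A ^ 3 = B ^ 3" "B ^ 3 = C ^ 3"
  proof -
    have "A ^ 3 = 0"
      by (rule tangential_aux[of "x ^ 3" "z ^ 3" "y ^ 3" _])
        (use that in \<open>simp_all only: A_def B_def C_def power_mult_distrib\<close>)
    with that show ?thesis by simp
  qed
  ultimately consider "A = 0" "B = 0" | "B = 0" "C = 0" | "C = 0" "A = 0" by blast
  then show ?thesis
  proof cases
    case 1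
    then show ?thesis
      unfolding A_def B_def by (intro vertex vertex_aux)
  next
    case 2
    then show ?thesis
      unfolding B_def C_def by (intro vertex) (use vertex_aux[of y x z] in metis)
  next
    case 3
    then show ?thesis
      unfolding A_def C_def by (intro vertex) (use vertex_aux[of z y x] in metis)
  qed
qed

text \<open>
  The heart of the matter, by one computation for each residue of \<open>i\<close>. On a
  smooth cubic any two of the points are distinct, so their chord is well defined, and the relations
  \<open>1 + \<omega>\<^sup>2 = \<omega> + \<omega>\<^sup>4 = - \<omega>\<^sup>3\<close> put the
  meet of the chords onto the cubic again. Both sides have degree 4, which is why they differ by a
  constant only.
\<close>

lemma skew_hesse:
  fixes a b c d :: int
  assumes "[a = 0] (mod 8)" and "[b = 2] (mod 8)" and "[c = 1] (mod 8)" and "[d = 4] (mod 8)"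
  obtains \<kappa> where "\<kappa> \<noteq> 0"
    "\<And>p. skew_step a b c d (\<lambda>i. hesse i p) i = (\<lambda>j. \<kappa> * hesse (i + 3) (tangential p) j)"
proof -
  have 8: "(i + a) mod 8 = i mod 8" "(i + b) mod 8 = (i mod 8 + 2) mod 8"
    "(i + c) mod 8 = (i mod 8 + 1) mod 8" "(i + d) mod 8 = (i mod 8 + 4) mod 8"
    "(i + 3) mod 8 = (i mod 8 + 3) mod 8" 
    using assms by (simp_all add: cong_def mod_simps flip: mod_add_right_eq[of i a] mod_add_right_eq[of i b]
      mod_add_right_eq[of i c] mod_add_right_eq[of i d])
  \<comment> \<open>up to a root of unity, each of these constants is a square root of \<open>- 3\<close>\<close>
  define \<kappa> where "\<kappa> = (if i mod 8 \<in> {0, 4} then 2 + \<zeta> else if i mod 8 \<in> {2, 6} then - (1 + 2 * \<zeta>)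
    else 1 + 2 * \<zeta>)"
  show ?thesis
  proof (rule that[of \<kappa>])
    show "\<kappa> \<noteq> 0" using zeta_nz by (auto simp: \<kappa>_def simp del: minus_add_distrib)
    fix p
    show "skew_step a b c d (\<lambda>i. hesse i p) i = (\<lambda>j. \<kappa> * hesse (i + 3) (tangential p) j)"
      by (cases i rule: mod_8_cases; rule fun3_eqI;
          simp add: skew_step_def hesse_simps 8 cross_simps tangential_def \<kappa>_def zeta_square;
          simp add: algebra_simps power3_eq_cube zeta_mult)
  qed
qed

section \<open>Homogeneous coordinates of projective points\<close>

lemma rep_abs_pspace:
  assumes "y \<noteq> (0 :: complex ^ 'n)"
  obtains k where "k \<noteq> 0" "\<And>j. rep_pspace (abs_pspace y) $ j = k * y $ j"
proof -
  have "proportional y y" using assms by (auto simp: proportional_def intro: exI[of _ 1])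
  then have "proportional (rep_pspace (abs_pspace y)) y"
    by (rule Quotient3_rep_abs[OF Quotient3_pspace])
  then obtain k where "k \<noteq> 0" "y = k *s rep_pspace (abs_pspace y)"
    unfolding proportional_def by blast
  then have "rep_pspace (abs_pspace y) $ j = inverse k * y $ j" for j
    by (metis (no_types) mult.assoc left_inverse mult_1 vector_smult_component)
  with \<open>k \<noteq> 0\<close> show ?thesis by (intro that[of "inverse k"]) simp_all
qed

lemma rep_pspace_nonzero: "rep_pspace p \<noteq> 0"
  using Quotient3_rep_reflp[OF Quotient3_pspace, of p] by (simp add: proportional_def)

lemma rep_pspace_eq_iff: "p = q \<longleftrightarrow> (\<exists>k. \<forall>j. rep_pspace q $ j = k * rep_pspace p $ j)"
proof -
  have "p = q \<longleftrightarrow> proportional (rep_pspace p) (rep_pspace q)"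
    by (rule Quotient3_rel_rep[OF Quotient3_pspace, symmetric])
  also have "\<dots> \<longleftrightarrow> (\<exists>k. \<forall>j. rep_pspace q $ j = k * rep_pspace p $ j)"
  proof
    assume "\<exists>k. \<forall>j. rep_pspace q $ j = k * rep_pspace p $ j"
    then obtain k where k: "rep_pspace q = k *s rep_pspace p" by (auto simp: vec_eq_iff)
    then have "k \<noteq> 0" using rep_pspace_nonzero[of q] by auto
    with k show "proportional (rep_pspace p) (rep_pspace q)"
      using rep_pspace_nonzero unfolding proportional_def by blast
  next
    assume "proportional (rep_pspace p) (rep_pspace q)"
    then obtain k where "rep_pspace q = k *s rep_pspace p" unfolding proportional_def by blast
    then show "\<exists>k. \<forall>j. rep_pspace q $ j = k * rep_pspace p $ j" by (metis vector_smult_component)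
  qed
  finally show ?thesis .
qed

definition coords :: "3 pspace \<Rightarrow> 3 \<Rightarrow> complex" where
  "coords p = ($) (rep_pspace p)"

lemma coords_abs:
  assumes "y j \<noteq> 0"
  obtains k where "k \<noteq> 0" "coords (abs_pspace (\<chi> j. y j)) = (\<lambda>j. k * y j)"
proof -
  have "(\<chi> j. y j) \<noteq> 0" using assms by (auto simp: vec_eq_iff)
  then obtain k where "k \<noteq> 0" "\<And>j. rep_pspace (abs_pspace (\<chi> j. y j)) $ j = k * (\<chi> j. y j) $ j"
    by (rule rep_abs_pspace) blast
  then show ?thesis using that by (auto simp: coords_def)
qed

lemma coords_nonzero: "\<exists>j. coords p j \<noteq> 0"
  using rep_pspace_nonzero[of p] by (auto simp: coords_def vec_eq_iff)

lemma coords_eq_iff: "p = q \<longleftrightarrow> (\<exists>k. \<forall>j. coords q j = k * coords p j)"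
  by (simp add: coords_def rep_pspace_eq_iff)

lemma eval_at_eq: "eval_at v p = eval (\<lambda>s. coords (v s)) p"
  by (simp add: eval_at_def eval_def coords_def)

lemma eval_at_skew_rule: "eval_at v (snd (skew_rule a b c d) j) = skew_step a b c d (\<lambda>s. coords (v s)) 0 j"
  by (simp add: eval_at_eq eval_skew_rule)

section \<open>Lines, joins and meets through cross products\<close>

lemma cross_zero_iff:
  fixes p q :: "3 \<Rightarrow> complex"
  assumes "p j \<noteq> 0"
  shows "(\<forall>l. cross p q l = 0) \<longleftrightarrow> (\<exists>k. \<forall>l. q l = k * p l)"
proof
  assume "\<forall>l. cross p q l = 0"
  then have "cross p q 1 = 0" "cross p q 2 = 0" "cross p q 3 = 0" by auto
  then have "p j * q l = q j * p l" for l
    using exhaust_3[of j] exhaust_3[of l] by (auto simp: cross_simps mult.commute)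
  then have "q l = (q j / p j) * p l" for l
    using assms by (simp add: field_simps)
  then show "\<exists>k. \<forall>l. q l = k * p l" by blast
next
  assume "\<exists>k. \<forall>l. q l = k * p l"
  then show "\<forall>l. cross p q l = 0" by (auto simp: cross_def triple_def)
qed

text \<open>
  Cramer's rule: if \<open>r\<close> is orthogonal to \<open>cross p q\<close>, its coefficients
  with respect to \<open>p\<close> and \<open>q\<close> are the quotients of the
  \<open>k\<close>-th coordinates of \<open>cross r q\<close> and \<open>cross p r\<close> by that
  of \<open>cross p q\<close>.
\<close>

lemma span_iff_dot_cross:
  fixes p q r :: "3 \<Rightarrow> complex"
  assumes "cross p q k \<noteq> 0"
  shows "(\<exists>\<alpha> \<beta>. \<forall>j. r j = \<alpha> * p j + \<beta> * q j) \<longleftrightarrow> dot (cross p q) r = 0"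
proof
  assume "\<exists>\<alpha> \<beta>. \<forall>j. r j = \<alpha> * p j + \<beta> * q j"
  then show "dot (cross p q) r = 0"
    by (auto simp: dot_def cross_simps algebra_simps)
next
  assume r: "dot (cross p q) r = 0"
  have "cross p q k * r j = cross r q k * p j + cross p r k * q j" for j
  proof -
    have "cross p q k * r j - (cross r q k * p j + cross p r k * q j)
        = (if j = k then dot (cross p q) r else 0)"
      using exhaust_3[of j] exhaust_3[of k] by (auto simp: dot_def cross_simps algebra_simps)
    then show ?thesis using r by (simp split: if_splits)
  qed
  then have "r j = (cross r q k / cross p q k) * p j + (cross p r k / cross p q k) * q j" for j
    using assms by (simp add: field_simps)
  then show "\<exists>\<alpha> \<beta>. \<forall>j. r j = \<alpha> * p j + \<beta> * q j" by blast
qed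

lemma proj_line_coords:
  "r \<in> proj_line p q \<longleftrightarrow> (\<exists>\<alpha> \<beta>. \<forall>j. coords r j = \<alpha> * coords p j + \<beta> * coords q j)"
  by (simp add: proj_line_def coords_def vec_eq_iff)

lemma coords_neq_iff: "p \<noteq> q \<longleftrightarrow> (\<exists>k. cross (coords p) (coords q) k \<noteq> 0)"
  using coords_nonzero[of p] cross_zero_iff coords_eq_iff by metis

lemma mem_proj_line:
  "p \<noteq> q \<Longrightarrow> r \<in> proj_line p q \<longleftrightarrow> dot (cross (coords p) (coords q)) (coords r) = 0"
  unfolding proj_line_coords coords_neq_iff using span_iff_dot_cross by blast

lemma cross_cross_right: "cross n (cross r s) = (\<lambda>j. dot n s * r j - dot n r * s j)"
  by (rule fun3_eqI) (simp_all add: cross_simps dot_def algebra_simps)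

lemma dot_cross: "dot n (cross n m) = 0" "dot m (cross n m) = 0"
  by (simp_all add: cross_simps dot_def algebra_simps)

lemma cross_nonzeroD:
  assumes "cross n m j \<noteq> 0"
  shows "\<exists>k. n k \<noteq> 0" "\<exists>k. m k \<noteq> 0"
proof -
  have "cross n m j = 0" if "\<forall>k. n k = 0" using that by (simp add: cross_def triple_def)
  then show "\<exists>k. n k \<noteq> 0" using assms by blast
  have "cross n m j = 0" if "\<forall>k. m k = 0" using that by (simp add: cross_def triple_def)
  then show "\<exists>k. m k \<noteq> 0" using assms by blast
qed

text \<open>
  A line is the kernel of the cross product of two of its points. The cross product of two such
  covectors vanishes iff the covectors are parallel, that is, the lines are equal, and otherwise
  it spans the intersection of the two kernels. So the single condition that the double cross
  product is nonzero captures all the conditions under which the skew pentagram map is defined.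
\<close>

lemma meet_of_lines:
  fixes p q r s :: "3 pspace"
  defines "n \<equiv> cross (coords p) (coords q)" and "m \<equiv> cross (coords r) (coords s)"
  shows "(p \<noteq> q \<and> r \<noteq> s \<and> proj_line p q \<noteq> proj_line r s) \<longleftrightarrow> (\<exists>j. cross n m j \<noteq> 0)"
    and "\<exists>j. cross n m j \<noteq> 0 \<Longrightarrow>
      (THE x. x \<in> proj_line p q \<inter> proj_line r s) = abs_pspace (\<chi> j. cross n m j)"
proof -
  have n0: "p \<noteq> q" and m0: "r \<noteq> s" if nz: "cross n m j \<noteq> 0" for j
    unfolding coords_neq_iff n_def[symmetric] m_def[symmetric]
    using cross_nonzeroD[OF nz] by blast+
  show "(p \<noteq> q \<and> r \<noteq> s \<and> proj_line p q \<noteq> proj_line r s) \<longleftrightarrow> (\<exists>j. cross n m j \<noteq> 0)"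
  proof
    assume L: "p \<noteq> q \<and> r \<noteq> s \<and> proj_line p q \<noteq> proj_line r s"
    show "\<exists>j. cross n m j \<noteq> 0"
    proof (rule ccontr)
      assume "\<nexists>j. cross n m j \<noteq> 0"
      moreover obtain i where "n i \<noteq> 0" using L coords_neq_iff n_def by blast
      ultimately obtain k where k: "\<And>l. m l = k * n l"
        using cross_zero_iff by metis
      moreover obtain i' where "m i' \<noteq> 0" using L coords_neq_iff m_def by blast
      ultimately have "k \<noteq> 0" by auto
      then have "dot m x = 0 \<longleftrightarrow> dot n x = 0" for x
        by (simp add: dot_def k mult.assoc flip: distrib_left)
      then have "proj_line p q = proj_line r s"
        using L by (auto simp: mem_proj_line n_def m_def)
      with L show False by blast
    qed
  next
    assume "\<exists>j. cross n m j \<noteq> 0"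
    then obtain j where j: "cross n m j \<noteq> 0" by blast
    have "proj_line p q \<noteq> proj_line r s"
    proof
      assume eq: "proj_line p q = proj_line r s"
      have "r \<in> proj_line p q" "s \<in> proj_line p q"
        unfolding eq mem_proj_line[OF m0[OF j]] using dot_cross
        by (simp_all add: dot_def cross_simps algebra_simps)
      then have "cross n m j = 0"
        by (simp add: mem_proj_line[OF n0[OF j]] m_def cross_cross_right flip: n_def)
      with j show False by simp
    qed
    with n0[OF j] m0[OF j] show "p \<noteq> q \<and> r \<noteq> s \<and> proj_line p q \<noteq> proj_line r s" by blast
  qed
  assume "\<exists>j. cross n m j \<noteq> 0"
  then obtain j where j: "cross n m j \<noteq> 0" by blast
  let ?x = "abs_pspace (\<chi> j. cross n m j)"
  have both: "x \<in> proj_line p q \<inter> proj_line r s \<longleftrightarrow> dot n (coords x) = 0 \<and> dot m (coords x) = 0" for x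
    using n0[OF j] m0[OF j] by (simp add: mem_proj_line n_def m_def)
  obtain k where k: "k \<noteq> 0" "coords ?x = (\<lambda>j. k * cross n m j)"
    using coords_abs[of "cross n m" j] j by blast
  show "(THE x. x \<in> proj_line p q \<inter> proj_line r s) = ?x"
  proof (rule the_equality)
    have "dot y (\<lambda>j. k * cross n m j) = k * dot y (cross n m)" for y
      by (simp add: dot_def algebra_simps)
    then show "?x \<in> proj_line p q \<inter> proj_line r s"
      unfolding both k by (simp add: dot_cross)
  next
    fix x assume "x \<in> proj_line p q \<inter> proj_line r s"
    then have "dot (coords x) n = 0" "dot (coords x) m = 0"
      unfolding both by (simp_all add: dot_def mult.commute)
    then have "cross (coords x) (coords ?x) l = 0" for l
      unfolding k using cross_scale[of 1 "coords x" k "cross n m"] by (simp add: cross_cross_right)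
    then show "x = ?x" using coords_neq_iff by blast
  qed
qed

lemma lattice_map_skew_rule: "lattice_map (skew_rule a b c d) = skew_pentagram a b c d"
proof
  fix v :: "3 config"
  have step: "eval_at (shift i v) (snd (skew_rule a b c d) j)
      = cross (cross (coords (v (i + a))) (coords (v (i + b))))
          (cross (coords (v (i + c))) (coords (v (i + d)))) j" for i j
    by (simp add: eval_at_skew_rule skew_step_def shift_def)
  have Ind: "shift i v \<notin> Ind (snd (skew_rule a b c d)) \<longleftrightarrow>
      v (i + a) \<noteq> v (i + b) \<and> v (i + c) \<noteq> v (i + d) \<and>
      proj_line (v (i + a)) (v (i + b)) \<noteq> proj_line (v (i + c)) (v (i + d))" for i
    unfolding meet_of_lines(1) by (simp add: Ind_def step)
  have "rat_apply (snd (skew_rule a b c d)) (shift i v) =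
      (THE p. p \<in> proj_line (v (i + a)) (v (i + b)) \<inter> proj_line (v (i + c)) (v (i + d)))"
    if "shift i v \<notin> Ind (snd (skew_rule a b c d))" for i
    unfolding rat_apply_def step
    by (rule meet_of_lines(2)[symmetric]) (use that in \<open>simp add: Ind_def step\<close>)
  then show "lattice_map (skew_rule a b c d) v = skew_pentagram a b c d v"
    unfolding lattice_map_def skew_pentagram_def Ind[symmetric] by (simp cong: if_cong)
qed

section \<open>Iterates of the skew pentagram map\<close>

locale skew_mod_8 =
  fixes a b c d :: int
  assumes residues: "[a = 0] (mod 8)" "[b = 2] (mod 8)" "[c = 1] (mod 8)" "[d = 4] (mod 8)"
begin

abbreviation "T \<equiv> skew_step a b c d"
abbreviation "R \<equiv> skew_rule a b c d"

text \<open>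
  Under iteration the parameter moves by \<open>tangential\<close> and the indices by 3. Arbitrary
  nonzero factors are allowed from the start, so that the statement covers any choice of
  homogeneous coordinates.
\<close>

lemma hesse_orbit:
  assumes "\<And>i. \<gamma> i \<noteq> 0"
  obtains \<gamma>' where "\<And>i. \<gamma>' i \<noteq> 0"
    "(T ^^ m) (\<lambda>i j. \<gamma> i * hesse i p j)
      = (\<lambda>i j. \<gamma>' i * hesse (i + 3 * int m) ((tangential ^^ m) p) j)"
proof -
  have "\<exists>\<gamma>'. (\<forall>i. \<gamma>' i \<noteq> 0) \<and> (T ^^ m) (\<lambda>i j. \<gamma> i * hesse i p j)
      = (\<lambda>i j. \<gamma>' i * hesse (i + 3 * int m) ((tangential ^^ m) p) j)"
  proof (induction m)
    case 0
    then show ?case using assms by auto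
  next
    case (Suc m)
    define q where "q = (tangential ^^ m) p"
    from Suc obtain \<gamma>' where \<gamma>': "\<And>i. \<gamma>' i \<noteq> 0"
      "(T ^^ m) (\<lambda>i j. \<gamma> i * hesse i p j) = (\<lambda>i j. \<gamma>' i * hesse (i + 3 * int m) q j)"
      by (auto simp: q_def)
    have "\<exists>\<kappa>. \<kappa> \<noteq> 0 \<and> (\<forall>j. T (\<lambda>i. hesse i q) i j = \<kappa> * hesse (i + 3) (tangential q) j)" for i
      using skew_hesse[OF residues, of i] by metis
    then obtain \<kappa> where \<kappa>: "\<And>i. \<kappa> i \<noteq> 0"
      "\<And>i j. T (\<lambda>i. hesse i q) i j = \<kappa> i * hesse (i + 3) (tangential q) j"
      by metis
    have shift: "T (\<lambda>i. hesse (i + k) q) i = T (\<lambda>i. hesse i q) (i + k)" for i k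
      by (simp add: skew_step_def ac_simps)
    define \<gamma>'' where "\<gamma>'' i = \<gamma>' (i + a) * \<gamma>' (i + b) * (\<gamma>' (i + c) * \<gamma>' (i + d)) *
        \<kappa> (i + 3 * int m)" for i
    have "(T ^^ Suc m) (\<lambda>i j. \<gamma> i * hesse i p j)
        = T (\<lambda>i j. \<gamma>' i * hesse (i + 3 * int m) q j)"
      by (simp only: funpow.simps o_apply \<gamma>'(2))
    also have "\<dots> = (\<lambda>i j. \<gamma>'' i * hesse (i + 3 * int m + 3) (tangential q) j)"
      by (simp only: skew_step_scale shift \<kappa>(2) \<gamma>''_def mult.assoc)
    also have "\<dots> = (\<lambda>i j. \<gamma>'' i * hesse (i + 3 * int (Suc m)) ((tangential ^^ Suc m) p) j)"
      by (simp add: q_def add.assoc add.commute[of "3 * int m"])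
    finally have "(T ^^ Suc m) (\<lambda>i j. \<gamma> i * hesse i p j)
        = (\<lambda>i j. \<gamma>'' i * hesse (i + 3 * int (Suc m)) ((tangential ^^ Suc m) p) j)" .
    moreover have "\<gamma>'' i \<noteq> 0" for i by (simp add: \<gamma>''_def \<gamma>' \<kappa>)
    ultimately show ?case by blast
  qed
  then show ?thesis using that by blast
qed

lemma tangential_power_vertex: "\<not> vertex p \<Longrightarrow> \<not> vertex ((tangential ^^ m) p)"
proof (induction m)
  case (Suc m)
  then have "\<not> vertex (tangential ((tangential ^^ m) p))"
    using tangential_vertex by blast
  then show ?case by (simp only: funpow.simps o_apply not_False_eq_True)
qed simp

lemma not_vertex_nonzero:
  assumes "\<not> vertex p"
  shows "\<exists>j. p j \<noteq> 0"
proof (rule ccontr)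
  assume "\<nexists>j. p j \<noteq> 0"
  then have "p 1 = 0" "p 2 = 0" by simp_all
  then have "vertex p" unfolding vertex_def by (intro disjI1 conjI)
  with assms show False ..
qed

lemma hesse_orbit_nonzero:
  assumes "\<not> vertex p" "\<And>i. \<gamma> i \<noteq> 0"
  shows "\<exists>l. (T ^^ m) (\<lambda>i j. \<gamma> i * hesse i p j) s l \<noteq> 0"
proof -
  obtain \<gamma>' where \<gamma>': "\<And>i. \<gamma>' i \<noteq> 0" "(T ^^ m) (\<lambda>i j. \<gamma> i * hesse i p j)
      = (\<lambda>i j. \<gamma>' i * hesse (i + 3 * int m) ((tangential ^^ m) p) j)"
    using hesse_orbit[of \<gamma> m p, OF assms(2)] by blast
  obtain j where "(tangential ^^ m) p j \<noteq> 0"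
    using not_vertex_nonzero[OF tangential_power_vertex[OF assms(1)]] by blast
  then obtain l where "hesse (s + 3 * int m) ((tangential ^^ m) p) l \<noteq> 0"
    using hesse_nonzero by blast
  then show ?thesis unfolding \<gamma>'(2) using \<gamma>'(1)[of s] by (intro exI[of _ l]) simp
qed

lemma norm_eq_of_cube_eq:
  fixes x y :: complex
  assumes "x ^ 3 = y ^ 3"
  shows "norm x = norm y"
proof (rule power_eq_imp_eq_base)
  show "norm x ^ 3 = norm y ^ 3"
    unfolding norm_power[symmetric] assms ..
qed simp_all

text \<open>
  The choice \<open>z = x + 3 y\<close> avoids all twelve vertices: on the line \<open>z = x + 3
  y\<close> at most one coordinate vanishes at a time, and equal cubes would give \<open>|x| = |y|
  = |z|\<close>, contrary to \<open>|3 y| \<le> |z| + |x|\<close>.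
\<close>

lemma plane_misses_vertices:
  assumes "x \<noteq> 0 \<or> y \<noteq> 0"
  shows "\<not> vertex (triple x y (x + 3 * y))"
proof
  assume v: "vertex (triple x y (x + 3 * y))"
  have False if xy: "x ^ 3 = y ^ 3" "y ^ 3 = (x + 3 * y) ^ 3"
  proof -
    have n: "norm x = norm y" "norm y = norm (x + 3 * y)"
      using xy by (auto intro: norm_eq_of_cube_eq)
    have "norm (3 * y) \<le> norm (x + 3 * y) + norm x"
      using norm_triangle_ineq4[of "x + 3 * y" x] by simp
    then have "norm y \<le> 0" using n by (simp add: norm_mult)
    then show False using n(1) assms by simp
  qed
  then have "(x = 0 \<and> y = 0) \<or> (y = 0 \<and> x + 3 * y = 0) \<or> (x + 3 * y = 0 \<and> x = 0)"
    using v unfolding vertex_def triple_simps by blast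
  then show False using assms by auto
qed

text \<open>
  The Hesse configurations with parameter \<open>(x, y, x + 3 y)\<close> depend linearly on
  \<open>(x, y)\<close>, so they form the plane of configurations required by
  \<open>common_factor_constant\<close>.
\<close>

lemma no_cancellation:
  fixes G :: "3 \<Rightarrow> 3 cpoly"
  assumes homog: "\<And>l. homogeneous monom_degree n (G l)"
    and k: "k \<noteq> 0" and G: "\<And>e l. eval e (G l) = k * (T ^^ m) e 0 l"
    and dvd: "\<And>l. H dvd G l"
  shows "\<exists>h. h \<noteq> 0 \<and> H = Const h"
proof (rule common_factor_constant[OF homog _ dvd])
  fix x y :: complex
  assume "x \<noteq> 0 \<or> y \<noteq> 0"
  then have "\<exists>l. (T ^^ m) (\<lambda>i j. 1 * hesse i (triple x y (x + 3 * y)) j) 0 l \<noteq> 0"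
    by (intro hesse_orbit_nonzero plane_misses_vertices) auto
  moreover have "hesse i (triple x y (x + 3 * y))
      = (\<lambda>j. x * hesse i (triple 1 0 1) j + y * hesse i (triple 0 1 3) j)" for i
  proof -
    have "triple x y (x + 3 * y) = (\<lambda>j. x * triple 1 0 1 j + y * triple 0 1 3 j)"
      by (rule fun3_eqI) simp_all
    then show ?thesis by (simp add: hesse_linear)
  qed
  ultimately show "\<exists>l. eval (\<lambda>s j. x * hesse s (triple 1 0 1) j + y * hesse s (triple 0 1 3) j) (G l) \<noteq> 0"
    using k by (simp add: G)
qed

text \<open>
  Both parts are needed in the induction: the values and the degree of the iterate show that it
  has no common factor, which makes the next cancellation trivial. The factor \<open>k\<close>
  collects the arbitrary constants introduced by \<open>cancel_common\<close>.
\<close>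

lemma iterate_rule:
  "(\<forall>l. homogeneous monom_degree (4 ^ m) (snd (iterate_rule R m) l)) \<and>
   (\<exists>k. k \<noteq> 0 \<and> (\<forall>e l. eval e (snd (iterate_rule R m) l) = k * (T ^^ m) e 0 l))"
proof (induction m)
  case 0
  then show ?case
    using homogeneous_Var by (auto simp: id_rule_def intro!: exI[of _ 1])
next
  case (Suc m)
  define G where "G = snd (iterate_rule R m)"
  from Suc obtain k where homog: "\<And>l. homogeneous monom_degree (4 ^ m) (G l)"
    and k: "k \<noteq> 0" and G: "\<And>e l. eval e (G l) = k * (T ^^ m) e 0 l"
    by (auto simp: G_def)
  define F where "F = (\<lambda>j. poly_hom Const (\<lambda>(s, l). shift_poly s (G l)) (snd R j))"
  have "homogeneous monom_degree (4 * 4 ^ m) (F j)" for j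
    unfolding F_def
    by (rule homogeneous_poly_hom[OF homogeneous_skew_rule])
      (simp add: case_prod_unfold homogeneous_shift_poly homog)
  then have F_homog: "homogeneous monom_degree (4 ^ Suc m) (F j)" for j by simp
  have "eval e (shift_poly s (G l)) = k * (T ^^ m) e s l" for e s l
    by (simp add: eval_shift_poly G skew_step_shift)
  then have F: "eval e (F j) = k ^ 4 * (T ^^ Suc m) e 0 j" for e j
    by (simp add: F_def eval_poly_hom eval_skew_rule skew_step_scale eval_nat_numeral)
  obtain h where h: "h \<noteq> 0" "\<And>j. cancel_common F j = Const h * F j"
    using cancel_common_trivial[of F] no_cancellation[OF F_homog _ F] k by auto
  have step: "snd (iterate_rule R (Suc m)) = (\<lambda>j. Const h * F j)"
    by (rule ext) (simp add: compose_rule_def F_def[unfolded G_def, symmetric] h)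
  have "homogeneous monom_degree (4 ^ Suc m) (Const h * F j)" for j
    using total.homogeneous_mult[OF homogeneous_Const F_homog] by simp
  moreover have "eval e (Const h * F j) = (h * k ^ 4) * (T ^^ Suc m) e 0 j" for e j
    by (simp only: eval_simps F mult.assoc)
  ultimately show ?case
    using h(1) k unfolding step by (intro conjI allI exI[of _ "h * k ^ 4"]) auto
qed

lemma base_not_vertex: "\<not> vertex (triple 1 0 1)"
  using plane_misses_vertices[of 1 0] by simp

lemma total_deg_iterate: "total_deg (snd (iterate_rule R m)) = 4 ^ m"
proof -
  obtain k where k: "k \<noteq> 0" "\<And>e l. eval e (snd (iterate_rule R m) l) = k * (T ^^ m) e 0 l"
    using iterate_rule[of m] by blast
  obtain l where "(T ^^ m) (\<lambda>i j. 1 * hesse i (triple 1 0 1) j) 0 l \<noteq> 0"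
    using hesse_orbit_nonzero[OF base_not_vertex, of "\<lambda>_. 1"] by auto
  then have "snd (iterate_rule R m) l \<noteq> 0"
    using k by (metis eval_simps(1) mult_eq_0_iff)
  then show ?thesis
    using total_deg_homogeneous iterate_rule[of m] by metis
qed

lemma local_rule: "local_rule R"
proof -
  define \<delta> where "\<delta> s = (\<lambda>t. if t = s then 1 else 0 :: nat)" for s :: int
  have "multihomogeneous (\<lambda>t. (\<delta> a t + \<delta> b t) + (\<delta> c t + \<delta> d t)) (snd R j)" for j
    unfolding skew_rule_def skew_step_def snd_conv \<delta>_def add_0
    by (intro multihomogeneous_cross multihomogeneous_Var)
  moreover have R: "\<And>e l. eval e (snd R l) = 1 * (T ^^ 1) e 0 l"
    by (simp add: eval_skew_rule)
  have "no_common_factor (snd R)"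
    unfolding no_common_factor_def
    using no_cancellation[OF homogeneous_skew_rule one_neq_zero R] Const_unit by metis
  moreover have "\<exists>j. snd R j \<noteq> 0"
  proof -
    obtain l where "(T ^^ 1) (\<lambda>i j. 1 * hesse i (triple 1 0 1) j) 0 l \<noteq> 0"
      using hesse_orbit_nonzero[OF base_not_vertex, of "\<lambda>_. 1" 1 0] by auto
    then have "eval (\<lambda>i j. 1 * hesse i (triple 1 0 1) j) (snd R l) \<noteq> 0" unfolding R by simp
    then show ?thesis by (intro exI[of _ l]) auto
  qed
  moreover have "\<delta> a t + \<delta> b t + (\<delta> c t + \<delta> d t) = 0" if "t \<notin> {a, b, c, d}" for t
    using that by (simp add: \<delta>_def)
  moreover have "fst R = {a, b, c, d}" by (simp add: skew_rule_def)
  ultimately show ?thesis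
    unfolding local_rule_def case_prod_unfold
    by (intro conjI exI[of _ "\<lambda>t. \<delta> a t + \<delta> b t + (\<delta> c t + \<delta> d t)"] allI impI) simp_all
qed

text \<open>
  The Hesse configuration of any non-vertex witnesses composability. The representatives chosen
  for its points are unknown multiples of the vectors in the table, but rescaling the points only
  rescales the orbit.
\<close>

lemma iterable: "iterable R"
  unfolding iterable_def composable_def
proof (intro allI notI)
  fix m
  define G where "G = snd (iterate_rule R m)"
  assume sub: "regional (fst R) (iterate_rule R m) ` regional_dom (fst R) (iterate_rule R m) \<subseteq> Ind (snd R)"
  let ?p = "triple 1 0 1 :: 3 \<Rightarrow> complex"
  define v :: "3 config" where "v = (\<lambda>i. abs_pspace (\<chi> j. hesse i ?p j))"
  have "\<exists>\<gamma>. \<gamma> \<noteq> 0 \<and> coords (v i) = (\<lambda>j. \<gamma> * hesse i ?p j)" for i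
    using hesse_nonzero[of ?p 1 i] coords_abs unfolding v_def by (metis triple_simps(1) zero_neq_one)
  then obtain \<gamma> where \<gamma>: "\<And>i. \<gamma> i \<noteq> 0" "\<And>i. coords (v i) = (\<lambda>j. \<gamma> i * hesse i ?p j)"
    by metis
  define e where "e = (\<lambda>i j. \<gamma> i * hesse i ?p j)"
  obtain k where k: "k \<noteq> 0" "\<And>e l. eval e (G l) = k * (T ^^ m) e 0 l"
    using iterate_rule[of m] unfolding G_def by blast
  have G_shift: "eval_at (shift i v) (G l) = k * (T ^^ m) e i l" for i l
    using skew_step_shift[of m a b c d e i]
    by (simp add: eval_at_eq k shift_def \<gamma>(2) e_def add.commute)
  have nz: "\<exists>l. (T ^^ m) e i l \<noteq> 0" for m i
    unfolding e_def by (rule hesse_orbit_nonzero[OF base_not_vertex \<gamma>(1)])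
  have dom: "v \<in> regional_dom (fst R) (iterate_rule R m)"
    using nz k by (simp add: regional_dom_def Ind_def G_shift flip: G_def)
  have "\<exists>\<mu>. \<mu> \<noteq> 0 \<and> coords (rat_apply G (shift i v)) = (\<lambda>j. \<mu> * (T ^^ m) e i j)" for i
  proof -
    obtain l where l: "(T ^^ m) e i l \<noteq> 0" using nz by blast
    obtain \<mu> where "\<mu> \<noteq> 0" "coords (rat_apply G (shift i v)) = (\<lambda>j. \<mu> * (k * (T ^^ m) e i j))"
      unfolding rat_apply_def G_shift using coords_abs[of "\<lambda>j. k * (T ^^ m) e i j" l] l k by auto
    then show ?thesis using k by (intro exI[of _ "\<mu> * k"]) (simp add: mult.assoc)
  qed
  then obtain \<mu> where \<mu>: "\<And>i. \<mu> i \<noteq> 0"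
    "\<And>i. coords (rat_apply G (shift i v)) = (\<lambda>j. \<mu> i * (T ^^ m) e i j)"
    by metis
  define v' where "v' = regional (fst R) (iterate_rule R m) v"
  have nbhd: "fst R = {a, b, c, d}" by (simp add: skew_rule_def)
  have v': "coords (v' i) = (\<lambda>j. \<mu> i * (T ^^ m) e i j)" if "i \<in> {a, b, c, d}" for i
    using that by (simp add: v'_def regional_def nbhd \<mu>(2) flip: G_def)
  have "v' \<in> Ind (snd R)" using sub dom by (auto simp: v'_def)
  then have "T (\<lambda>s. coords (v' s)) 0 l = 0" for l
    by (simp add: Ind_def eval_at_skew_rule)
  moreover have "T (\<lambda>s. coords (v' s)) 0 = T (\<lambda>i j. \<mu> i * (T ^^ m) e i j) 0"
    by (simp add: skew_step_def v')
  ultimately have "(T ^^ Suc m) e 0 l = 0" for l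
    by (simp add: skew_step_scale \<mu>(1))
  then show False using nz[of "Suc m" 0] by blast
qed

end

theorem theorem7p18:
  fixes a b c d :: int
  assumes "[a = 0] (mod 8)" and "[b = 2] (mod 8)" and "[c = 1] (mod 8)" and "[d = 4] (mod 8)"
  shows "has_dynamical_degree (skew_pentagram a b c d) 4"
proof -
  interpret skew_mod_8 a b c d by unfold_locales (rule assms)+
  have "root m (real (total_deg (snd (iterate_rule R m)))) = 4" if "m > 0" for m
    using that by (simp add: total_deg_iterate real_root_power_cancel)
  then have "(\<lambda>m. root m (real (total_deg (snd (iterate_rule R m))))) \<longlonglongrightarrow> 4"
    by (intro tendsto_eventually eventually_mono[OF eventually_gt_at_top[of 0]])
  then show ?thesis
    unfolding has_dynamical_degree_def
    using local_rule iterable lattice_map_skew_rule by blast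
qed

end
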